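(* Let $n\ge 1$, let $I_1,\ldots,I_n$ be independent random variables with values in $\{0,1\}$, $p_i=\Pr(I_i=1)=1-\Pr(I_i=0)\in[0,1]$, and let $S_n=I_1+\cdots+I_n$, with probability mass function $f_n(k)=\Pr(S_n=k)$, $k=0,1,\ldots$. Put $\lambda_j=\sum_{i=1}^n p_i^j$ for $j=1,2,\ldots$ and $\lambda=\lambda_1=\sum_{i=1}^n p_i$, and assume $\lambda>0$. Define $$\phi_2(k)=e^{-\lambda}\frac{\lambda^k}{k!}\Big(1-\frac{\lambda_2}{2\lambda^2}\big((k-\lambda)^2-k\big)\Big),\qquad k=0,1,\ldots.$$ Then $$d_{\mathrm{tv}}(f_n,\phi_2)\le d_2(f_n,\phi_2)\le\left(\frac43\lambda_3+\lambda_2^2\right)e^{2\lambda}\le\left(\frac43+\lambda\right)e^{2\lambda}\sum_{i=1}^n p_i^3.$$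
   Context: Let $\mathcal F_2$ be the set of functions $g:\{0,1,\ldots\}\to\mathbb R$ such that $\sum_{k=0}^\infty |g(k)|u^k<\infty$ for some $u>2$ and $\sum_{k=0}^\infty g(k)=1$ ($g$ may take negative values). Both $f_n$ and $\phi_2$ belong to $\mathcal F_2$. For $g\in\mathcal F_2$ the $m$-th factorial moment is $\mu_m(g)=\sum_{k=m}^\infty (k)_m\,g(k)$, $m=0,1,\ldots$, where $(k)_m=k(k-1)\cdots(k-m+1)$ and $(k)_0=1$. For $g_1,g_2\in\mathcal F_2$ define $$d_{\mathrm{tv}}(g_1,g_2)=\frac12\sum_{k=0}^\infty|g_1(k)-g_2(k)|,\qquad d_2(g_1,g_2)=\frac12\sum_{m=1}^\infty\frac{2^m}{m!}\,|\mu_m(g_1)-\mu_m(g_2)|.$$ *)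

theory Defs
  imports "HOL-Probability.Probability"
begin

definition class_F2 :: "(nat \<Rightarrow> real) set" where
  "class_F2 = {g. (\<exists>u>2. summable (\<lambda>k. \<bar>g k\<bar> * u ^ k)) \<and> g sums 1}"

definition falling_fact :: "nat \<Rightarrow> nat \<Rightarrow> real" where
  "falling_fact k m = (\<Prod>i<m. real k - real i)"

(* The series over k >= m is indexed from 0 by k + m. *)
definition factorial_moment :: "nat \<Rightarrow> (nat \<Rightarrow> real) \<Rightarrow> real" where
  "factorial_moment m g = (\<Sum>k. falling_fact (k + m) m * g (k + m))"

(* Both distances take values in [0, \<infinity>]: an upper bound by a finite number therefore
   includes the convergence of the series.  For d2 this is not automatic, since elements of
   class_F2 can have infinite d2 distance. *)
definition d_tv :: "(nat \<Rightarrow> real) \<Rightarrow> (nat \<Rightarrow> real) \<Rightarrow> ennreal" where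
  "d_tv g1 g2 = ennreal (1 / 2) * (\<Sum>k. ennreal \<bar>g1 k - g2 k\<bar>)"

(* The series over m >= 1 is indexed from 0 by Suc m. *)
definition d2 :: "(nat \<Rightarrow> real) \<Rightarrow> (nat \<Rightarrow> real) \<Rightarrow> ennreal" where
  "d2 g1 g2 = ennreal (1 / 2) *
     (\<Sum>m. ennreal (2 ^ Suc m / fact (Suc m) *
        \<bar>factorial_moment (Suc m) g1 - factorial_moment (Suc m) g2\<bar>))"

definition power_sum :: "nat \<Rightarrow> (nat \<Rightarrow> real) \<Rightarrow> nat \<Rightarrow> real" where
  "power_sum n p j = (\<Sum>i = 1..n. p i ^ j)"

definition phi2 :: "nat \<Rightarrow> (nat \<Rightarrow> real) \<Rightarrow> nat \<Rightarrow> real" where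
  "phi2 n p k = (let l = power_sum n p 1; l2 = power_sum n p 2 in
     exp (- l) * (l ^ k / fact k) * (1 - l2 / (2 * l\<^sup>2) * ((real k - l)\<^sup>2 - real k)))"

definition sum_mass :: "'a measure \<Rightarrow> nat \<Rightarrow> (nat \<Rightarrow> 'a \<Rightarrow> nat) \<Rightarrow> nat \<Rightarrow> real" where
  "sum_mass M n I k = measure M {x \<in> space M. (\<Sum>i = 1..n. I i x) = k}"

text \<open>The series defining the factorial moments converge on \<open>class_F2\<close>, to which both
  \<open>sum_mass\<close> and \<open>phi2\<close> belong; so \<open>suminf\<close> is never applied to a divergent real series.\<close>

lemma falling_fact_eq: "falling_fact k m = fact m * real (k choose m)"
proof -
  have "real (k choose m) = (real k gchoose m)"
    by (simp add: binomial_gbinomial)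
  then show ?thesis
    by (simp add: gbinomial_prod_rev falling_fact_def lessThan_atLeast0)
qed

lemma summable_factorial_moment:
  assumes "g \<in> class_F2"
  shows "summable (\<lambda>k. falling_fact (k + m) m * g (k + m))"
proof -
  obtain u where u: "u > 2" "summable (\<lambda>k. \<bar>g k\<bar> * u ^ k)"
    using assms by (auto simp: class_F2_def)
  have "summable (\<lambda>k. falling_fact k m * g k)"
  proof (rule summable_comparison_test')
    show "summable (\<lambda>k. fact m * (\<bar>g k\<bar> * u ^ k))"
      using u by (intro summable_mult)
    fix k :: nat assume "k \<ge> 0"
    have "k choose m \<le> 2 ^ k"
    proof (cases "m \<le> k")
      case True
      then have "k choose m \<le> (\<Sum>i\<le>k. k choose i)"
        by (intro member_le_sum) auto
      then show ?thesis by (simp add: choose_row_sum)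
    qed (simp add: binomial_eq_0)
    then have "real (k choose m) \<le> 2 ^ k"
      by (metis of_nat_le_iff of_nat_numeral of_nat_power)
    also have "\<dots> \<le> u ^ k" using u by (intro power_mono) auto
    finally have "real (k choose m) * \<bar>g k\<bar> \<le> u ^ k * \<bar>g k\<bar>"
      by (intro mult_right_mono) auto
    then show "norm (falling_fact k m * g k) \<le> fact m * (\<bar>g k\<bar> * u ^ k)"
      by (simp add: falling_fact_eq abs_mult mult_ac)
  qed
  then show ?thesis by (rule summable_ignore_initial_segment)
qed

lemma sum_mass_in_class_F2:
  assumes "prob_space M"
    and meas: "\<And>i. i \<in> {1..n} \<Longrightarrow> I i \<in> measurable M (count_space UNIV)"
    and val: "\<And>i x. i \<in> {1..n} \<Longrightarrow> x \<in> space M \<Longrightarrow> I i x \<in> {0, 1}"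
  shows "sum_mass M n I \<in> class_F2"
proof -
  interpret prob_space M by fact
  define S where "S x = (\<Sum>i = 1..n. I i x)" for x
  have S: "S \<in> measurable M (count_space UNIV)"
    unfolding S_def using meas by (intro measurable_sum_nat) auto
  have le: "S x \<le> n" if "x \<in> space M" for x
  proof -
    have "S x \<le> (\<Sum>i = 1..n. 1)"
      unfolding S_def using val that by (intro sum_mono) fastforce
    then show ?thesis by simp
  qed
  have f: "sum_mass M n I k = prob {x \<in> space M. S x = k}" for k
    by (simp add: sum_mass_def S_def)
  have ev: "{x \<in> space M. S x = k} \<in> events" for k
    using measurable_sets[OF S, of "{k}"] by (simp add: vimage_def Int_def conj_commute)
  have zero: "sum_mass M n I k = 0" if "k \<notin> {..n}" for k
  proof -
    have "{x \<in> space M. S x = k} = {}" using le that by auto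
    then show ?thesis by (simp only: f measure_empty)
  qed
  have "(\<Sum>k\<le>n. sum_mass M n I k) = prob (\<Union>k\<in>{..n}. {x \<in> space M. S x = k})"
    unfolding f using ev
    by (intro finite_measure_finite_Union[symmetric]) (auto simp: disjoint_family_on_def)
  also have "(\<Union>k\<in>{..n}. {x \<in> space M. S x = k}) = space M"
    using le by auto
  finally have "sum_mass M n I sums 1"
    using sums_finite[of "{..n}" "sum_mass M n I"] zero by (simp add: prob_space)
  moreover have "summable (\<lambda>k. \<bar>sum_mass M n I k\<bar> * 3 ^ k)"
    using zero by (intro summable_finite[of "{..n}"]) auto
  ultimately show ?thesis
    unfolding class_F2_def by (auto intro!: exI[of _ 3])
qed

lemma exp_moment_sums:
  fixes x a b c :: real
  shows "(\<lambda>k. x ^ k / fact k * (a * (real k * (real k - 1)) + b * real k + c))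
    sums ((a * x\<^sup>2 + b * x + c) * exp x)"
proof -
  have 0: "(\<lambda>k. x ^ k / fact k) sums exp x"
    using exp_converges[of x] by (simp add: field_simps)
  have "(\<lambda>k. x ^ Suc k / fact (Suc k) * real (Suc k)) sums (x * exp x)"
    using sums_mult[OF 0, of x] by (simp add: field_simps del: of_nat_Suc)
  then have 1: "(\<lambda>k. x ^ k / fact k * real k) sums (x * exp x)"
    by (subst (asm) sums_Suc_iff) simp
  have "(\<lambda>k. x ^ Suc k / fact (Suc k) * (real (Suc k) * (real (Suc k) - 1)))
    sums (x * (x * exp x))"
    using sums_mult[OF 1, of x] by (simp add: divide_simps mult_ac)
  then have 2: "(\<lambda>k. x ^ k / fact k * (real k * (real k - 1))) sums (x * (x * exp x))"
    by (subst (asm) sums_Suc_iff) simp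
  have "(\<lambda>k. a * (x ^ k / fact k * (real k * (real k - 1))) + b * (x ^ k / fact k * real k)
      + c * (x ^ k / fact k)) sums (a * (x * (x * exp x)) + b * (x * exp x) + c * exp x)"
    by (intro sums_add sums_mult 0 1 2)
  then show ?thesis by (simp add: algebra_simps power2_eq_square)
qed

lemma phi2_in_class_F2:
  assumes "power_sum n p 1 > 0"
  shows "phi2 n p \<in> class_F2"
proof -
  define l where "l = power_sum n p 1"
  define d where "d = power_sum n p 2 / (2 * l\<^sup>2)"
  have l: "l > 0" using assms by (simp add: l_def)
  have phi: "phi2 n p k = exp (- l) *
      (l ^ k / fact k * ((- d) * (real k * (real k - 1)) + (2 * d * l) * real k + (1 - d * l\<^sup>2)))" for k
    unfolding phi2_def Let_def l_def[symmetric] d_def[symmetric]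
    by (simp add: algebra_simps power2_eq_square)
  have "phi2 n p sums (exp (- l) * (((- d) * l\<^sup>2 + (2 * d * l) * l + (1 - d * l\<^sup>2)) * exp l))"
    unfolding phi[abs_def] by (intro sums_mult exp_moment_sums)
  moreover have "exp (- l) * (((- d) * l\<^sup>2 + (2 * d * l) * l + (1 - d * l\<^sup>2)) * exp l) = 1"
    by (simp add: algebra_simps power2_eq_square flip: exp_add)
  ultimately have "phi2 n p sums 1" by simp
  moreover have "summable (\<lambda>k. \<bar>phi2 n p k\<bar> * 3 ^ k)"
  proof (rule summable_comparison_test')
    show "summable (\<lambda>k. exp (- l) * ((3 * l) ^ k / fact k *
        (\<bar>d\<bar> * (real k * (real k - 1)) + (2 * \<bar>d\<bar> * l) * real k + (1 + \<bar>d\<bar> * l\<^sup>2))))"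
      by (intro summable_mult sums_summable[OF exp_moment_sums])
    fix k :: nat assume "k \<ge> 0"
    have k: "real k * (real k - 1) \<ge> 0" by (cases k) auto
    have "\<bar>(- d) * (real k * (real k - 1)) + (2 * d * l) * real k + (1 - d * l\<^sup>2)\<bar>
      \<le> \<bar>(- d) * (real k * (real k - 1))\<bar> + \<bar>(2 * d * l) * real k\<bar> + (\<bar>1\<bar> + \<bar>d * l\<^sup>2\<bar>)"
      by linarith
    also have "\<dots> = \<bar>d\<bar> * (real k * (real k - 1)) + (2 * \<bar>d\<bar> * l) * real k + (1 + \<bar>d\<bar> * l\<^sup>2)"
      using abs_of_nonneg[OF k] l abs_mult[of "- d" "real k * (real k - 1)"] by (simp only: abs_minus_cancel) (simp add: abs_mult)
    finally have "exp (- l) * ((3 * l) ^ k / fact k *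
        \<bar>(- d) * (real k * (real k - 1)) + (2 * d * l) * real k + (1 - d * l\<^sup>2)\<bar>)
      \<le> exp (- l) * ((3 * l) ^ k / fact k *
        (\<bar>d\<bar> * (real k * (real k - 1)) + (2 * \<bar>d\<bar> * l) * real k + (1 + \<bar>d\<bar> * l\<^sup>2)))"
      using l by (intro mult_left_mono) auto
    then show "norm (\<bar>phi2 n p k\<bar> * 3 ^ k) \<le> exp (- l) * ((3 * l) ^ k / fact k *
        (\<bar>d\<bar> * (real k * (real k - 1)) + (2 * \<bar>d\<bar> * l) * real k + (1 + \<bar>d\<bar> * l\<^sup>2)))"
      using l by (simp only: phi abs_mult) (simp add: power_mult_distrib mult_ac)
  qed
  ultimately show ?thesis
    unfolding class_F2_def by (auto intro!: exI[of _ 3])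
qed

end

theory Submission
  imports Defs "HOL-Computational_Algebra.Polynomial_FPS"
begin

text \<open>
  The generating function of \<open>S_n\<close>, expanded at 1, is
  \<open>F(z) = E (1 + z) ^ S_n = (\<Prod>i. 1 + p_i z)\<close>, and that of \<open>\<phi>_2\<close> is
  \<open>(1 - \<lambda>_2 z\<^sup>2 / 2) e ^ (\<lambda> z)\<close>.  The coefficient of \<open>z ^ m\<close> in such an expansion is the
  \<open>m\<close>-th factorial moment divided by \<open>m!\<close>, called the binomial moment below.  Hence \<open>d_2\<close> is one
  half of the sum of \<open>2 ^ m\<close> times the absolute coefficients of the difference of the two power
  series, the constant coefficients being equal.

  For the first inequality, the binomial moments determine the function: on \<open>class_F2\<close> the
  inversion formula \<open>g k = (\<Sum>m. (-1) ^ (m + k) (m choose k) b_m)\<close> holds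
  (\<open>binomial_inversion\<close>), because the exponential weight \<open>u ^ k\<close> with \<open>u > 2\<close> makes the
  double series absolutely convergent.  Taking absolute values, summing over \<open>k\<close> and using
  \<open>(\<Sum>k. m choose k) = 2 ^ m\<close> gives \<open>d_tv \<le> d_2\<close> for any two members of the class
  (\<open>d_tv_le_d2\<close>).

  For the second inequality, the difference of the two series is bounded coefficient by
  coefficient by the series
  \<open>(\<lambda>_3 z ^ 3 / 3 + \<lambda>_2\<^sup>2 z ^ 4 / 8) e ^ (\<lambda> z)\<close>
  (\<open>prod_linear_second_order_majorized\<close>), whose value at \<open>z = 2\<close> is twice the claimed bound.
  The majorant is found by exchanging the factors \<open>1 + p_i z\<close> for \<open>e ^ (p_i z)\<close> one at a time.
  Keeping the unexchanged linear factors, rather than dividing by the exponentials, is what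
  produces \<open>e ^ (2 \<lambda>)\<close>: each factor, of either kind, is majorized by \<open>e ^ (p_i z)\<close>, so every
  product of such factors contributes no more than \<open>e ^ (\<lambda> z)\<close>.

  The last inequality is \<open>\<lambda>_2\<^sup>2 \<le> \<lambda> \<lambda>_3\<close>, an instance of the Cauchy-Schwarz inequality.
\<close>

text \<open>Vector components and coefficients of power series share the symbol \<open>$\<close>; only the latter
  occur here.\<close>

unbundle no vec_syntax
unbundle fps_syntax

section \<open>Binomial moments and the total variation distance\<close>

text \<open>The subset-of-a-subset identity
  \<open>(j choose m) (m choose k) = (j choose k) ((j - k) choose (m - k))\<close>, summed against a weight.
  With constant weight it controls the absolute convergence in the inversion formula, and with
  alternating weight it is the orthogonality relation behind that formula.\<close>

lemma sum_binomial_product_reindex: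
  "(\<Sum>m\<le>j. real (j choose m) * real (m choose k) * f m)
    = (\<Sum>i\<le>j - k. real (j choose k) * (real ((j - k) choose i) * f (i + k)))"
proof (cases "k \<le> j")
  case True
  have "(\<Sum>m\<le>j. real (j choose m) * real (m choose k) * f m)
      = (\<Sum>m\<in>{k..j}. real (j choose m) * real (m choose k) * f m)"
    by (intro sum.mono_neutral_right) (auto simp: binomial_eq_0)
  also have "\<dots> = (\<Sum>m\<in>{k..j}. real (j choose k) * (real ((j - k) choose (m - k)) * f m))"
    by (intro sum.cong) (simp_all add: choose_mult flip: of_nat_mult mult.assoc)
  also have "\<dots> = (\<Sum>i\<le>j - k. real (j choose k) * (real ((j - k) choose i) * f (i + k)))"
    by (rule sum.reindex_bij_witness[of _ "\<lambda>i. i + k" "\<lambda>m. m - k"]) (use True in auto)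
  finally show ?thesis .
next
  case False
  then show ?thesis by (auto simp: binomial_eq_0 intro!: sum.neutral)
qed

lemma sum_binomial_product:
  "(\<Sum>m\<le>j. real (j choose m) * real (m choose k)) = real (j choose k) * 2 ^ (j - k)"
proof -
  have "(\<Sum>m\<le>j. real (j choose m) * real (m choose k))
      = real (j choose k) * real (\<Sum>i\<le>j - k. (j - k) choose i)"
    using sum_binomial_product_reindex[of j k "\<lambda>_. 1"] by (simp add: sum_distrib_left)
  then show ?thesis by (simp add: choose_row_sum)
qed

lemma sum_binomial_product_alternating:
  "(\<Sum>m\<le>j. real (j choose m) * real (m choose k) * (- 1) ^ (m + k)) = (if j = k then 1 else 0)"
proof -
  have "(\<Sum>m\<le>j. real (j choose m) * real (m choose k) * (- 1) ^ (m + k))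
      = real (j choose k) * (\<Sum>i\<le>j - k. (- 1) ^ i * real ((j - k) choose i))"
    by (subst sum_binomial_product_reindex) (simp add: sum_distrib_left power_add mult_ac flip: power_mult_distrib)
  also have "\<dots> = (if j = k then 1 else 0)"
    using choose_alternating_sum[of "j - k", where 'a = real]
    by (cases "j \<le> k") (auto simp: binomial_eq_0)
  finally show ?thesis .
qed

definition binomial_moment :: "nat \<Rightarrow> (nat \<Rightarrow> real) \<Rightarrow> real" where
  "binomial_moment m g = (\<Sum>j. real (j choose m) * g j)"

lemma summable_binomial_moment:
  assumes "2 < u" "summable (\<lambda>k. \<bar>g k\<bar> * u ^ k)"
  shows "summable (\<lambda>j. \<bar>real (j choose m) * g j\<bar>)"
proof (rule summable_comparison_test'[OF assms(2)])
  fix j :: nat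
  have "j choose m \<le> 2 ^ j"
    by (cases "m \<le> j") (use member_le_sum[of m "{..j}" "\<lambda>m. j choose m"] in
        \<open>auto simp: choose_row_sum binomial_eq_0\<close>)
  then have "real (j choose m) \<le> 2 ^ j"
    by (metis of_nat_le_iff of_nat_numeral of_nat_power)
  also have "\<dots> \<le> u ^ j" using assms by (intro power_mono) auto
  finally show "norm \<bar>real (j choose m) * g j\<bar> \<le> \<bar>g j\<bar> * u ^ j"
    by (simp add: abs_mult mult.commute mult_left_mono)
qed

lemma factorial_moment_eq_binomial_moment:
  assumes "g \<in> class_F2"
  shows "factorial_moment m g = fact m * binomial_moment m g"
proof -
  obtain u where u: "2 < u" "summable (\<lambda>k. \<bar>g k\<bar> * u ^ k)"
    using assms by (auto simp: class_F2_def)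
  have s: "summable (\<lambda>j. real (j choose m) * g j)"
    by (rule summable_rabs_cancel[OF summable_binomial_moment[OF u]])
  have "binomial_moment m g = (\<Sum>k. real ((k + m) choose m) * g (k + m))"
    unfolding binomial_moment_def
    by (subst suminf_split_initial_segment[OF s, of m]) (simp add: binomial_eq_0)
  moreover have "summable (\<lambda>k. real ((k + m) choose m) * g (k + m))"
    using s by (rule summable_ignore_initial_segment)
  ultimately show ?thesis
    by (simp add: factorial_moment_def falling_fact_eq mult.assoc suminf_mult)
qed

text \<open>The term \<open>(j choose k) e ^ k\<close> is one summand of \<open>(1 + e) ^ j\<close>; with \<open>e = u / 2 - 1\<close>,
  which is positive since \<open>u > 2\<close>, the factor \<open>(2 (1 + e)) ^ j\<close> equals \<open>u ^ j\<close>.\<close>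

lemma choose_times_power_2_le:
  assumes "2 < (u::real)"
  shows "real (j choose k) * 2 ^ (j - k) \<le> (1 / (u / 2 - 1)) ^ k * u ^ j"
proof (cases "k \<le> j")
  case True
  define e where "e = u / 2 - 1"
  have e: "e > 0" using assms by (simp add: e_def)
  have "real (j choose k) * e ^ k \<le> (\<Sum>i\<le>j. real (j choose i) * e ^ i)"
    using True e by (intro member_le_sum[of k "{..j}"]) auto
  also have "\<dots> = (e + 1) ^ j"
    using binomial_ring[of e 1 j] by simp
  finally have "2 ^ j * (real (j choose k) * e ^ k) \<le> 2 ^ j * (e + 1) ^ j"
    by (intro mult_left_mono) auto
  also have "\<dots> = u ^ j"
    by (simp add: e_def flip: power_mult_distrib)
  finally have "real (j choose k) * 2 ^ j \<le> (1 / e) ^ k * u ^ j"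
    using e by (simp add: field_simps)
  moreover have "real (j choose k) * 2 ^ (j - k) \<le> real (j choose k) * 2 ^ j"
    by (intro mult_left_mono power_increasing) auto
  ultimately show ?thesis by (simp add: e_def)
qed (use assms in \<open>simp add: binomial_eq_0\<close>)

text \<open>Insert the definition of the binomial moments and exchange the two summations.  For fixed \<open>j\<close>
  the sum over \<open>m\<close> is finite and, by orthogonality, equals \<open>g k\<close> if \<open>j = k\<close> and \<open>0\<close> otherwise.
  In absolute value it is \<open>(j choose k) 2 ^ (j - k) \<bar>g j\<bar>\<close>, which is summable over \<open>j\<close>, so
  Fubini's theorem applies.\<close>

lemma binomial_inversion:
  assumes u: "2 < u" "summable (\<lambda>k. \<bar>g k\<bar> * u ^ k)"
  shows "(\<lambda>m. (- 1) ^ (m + k) * real (m choose k) * binomial_moment m g) sums g k"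
    and "summable (\<lambda>m. \<bar>real (m choose k) * binomial_moment m g\<bar>)"
proof -
  define h where "h j m = real (j choose m) * real (m choose k) * (- 1) ^ (m + k) * g j" for j m
  \<comment> \<open>Used with \<open>f\<close> the absolute value and the identity.\<close>
  have inner: "((\<lambda>m. f (h j m)) has_sum (\<Sum>m\<le>j. f (h j m))) UNIV" if "f 0 = (0::real)" for j f
    by (rule has_sum_finite_neutralI) (auto simp: h_def binomial_eq_0 that)
  have abs_h: "(\<Sum>m\<le>j. \<bar>h j m\<bar>) = real (j choose k) * 2 ^ (j - k) * \<bar>g j\<bar>" for j
    by (simp add: h_def abs_mult power_abs sum_binomial_product flip: sum_distrib_right)
  have plain_h: "(\<Sum>m\<le>j. h j m) = (if j = k then g k else 0)" for j
    by (simp add: h_def sum_binomial_product_alternating flip: sum_distrib_right)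
  have "summable (\<lambda>j. real (j choose k) * 2 ^ (j - k) * \<bar>g j\<bar>)"
  proof (rule summable_comparison_test')
    show "summable (\<lambda>j. (1 / (u / 2 - 1)) ^ k * (\<bar>g j\<bar> * u ^ j))"
      by (intro summable_mult u)
    show "norm (real (j choose k) * 2 ^ (j - k) * \<bar>g j\<bar>) \<le> (1 / (u / 2 - 1)) ^ k * (\<bar>g j\<bar> * u ^ j)" for j
      using mult_right_mono[OF choose_times_power_2_le[OF u(1), of j k], of "\<bar>g j\<bar>"]
      by (simp add: abs_mult mult_ac)
  qed
  then have "(\<lambda>j. norm (\<Sum>\<^sub>\<infinity>m. \<bar>h j m\<bar>)) summable_on UNIV"
    using infsumI[OF inner[of abs]] by (simp add: abs_h summable_on_UNIV_nonneg_real_iff)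
  then have abs1: "(\<lambda>x. norm (case x of (j, m) \<Rightarrow> h j m)) summable_on UNIV \<times> UNIV"
    using has_sum_imp_summable[OF inner[of abs]] by (subst Infinite_Sum.abs_summable_on_Sigma_iff) simp
  have abs2: "(\<lambda>x. norm (case x of (m, j) \<Rightarrow> h j m)) summable_on UNIV \<times> UNIV"
    using abs1 by (subst summable_on_swap) (simp add: case_prod_unfold)
  have col: "(\<Sum>\<^sub>\<infinity>j. h j m) = (- 1) ^ (m + k) * real (m choose k) * binomial_moment m g" for m
  proof -
    have "((\<lambda>j. real (j choose m) * g j) has_sum binomial_moment m g) UNIV"
      unfolding binomial_moment_def
      using norm_summable_imp_has_sum[of "\<lambda>j. real (j choose m) * g j"]
        summable_binomial_moment[OF u, of m] summable_sums[OF summable_rabs_cancel]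
      by auto
    from has_sum_cmult_right[OF this, of "(- 1) ^ (m + k) * real (m choose k)"] show ?thesis
      by (intro infsumI) (simp add: h_def mult_ac)
  qed
  have sum2: "(\<lambda>(m, j). h j m) summable_on UNIV \<times> UNIV"
    using abs2 by (rule abs_summable_summable)
  have "(\<lambda>m. \<Sum>\<^sub>\<infinity>j. h j m) summable_on UNIV"
    using summable_on_Sigma_banach[OF sum2] by simp
  then have hs: "((\<lambda>m. \<Sum>\<^sub>\<infinity>j. h j m) has_sum (\<Sum>\<^sub>\<infinity>m. \<Sum>\<^sub>\<infinity>j. h j m)) UNIV"
    and abs: "(\<lambda>m. norm (\<Sum>\<^sub>\<infinity>j. h j m)) summable_on UNIV"
    by (rule has_sum_infsum, rule iffD1[OF summable_on_iff_abs_summable_on_real])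
  have "(\<Sum>\<^sub>\<infinity>m. \<Sum>\<^sub>\<infinity>j. h j m) = (\<Sum>\<^sub>\<infinity>j. \<Sum>\<^sub>\<infinity>m. h j m)"
    by (rule infsum_swap_banach[OF sum2])
  also have "\<dots> = (\<Sum>\<^sub>\<infinity>j. if j = k then g k else 0)"
    using infsumI[OF inner[of "\<lambda>x. x"]] by (simp add: plain_h)
  also have "\<dots> = g k"
    using has_sum_finite_neutralI[of "{k}" UNIV "\<lambda>j. if j = k then g k else 0" "g k"]
    by (intro infsumI) auto
  finally show "(\<lambda>m. (- 1) ^ (m + k) * real (m choose k) * binomial_moment m g) sums g k"
    using has_sum_imp_sums[OF hs] by (simp add: col)
  show "summable (\<lambda>m. \<bar>real (m choose k) * binomial_moment m g\<bar>)"
    using summable_on_imp_summable[OF abs] by (simp add: col abs_mult power_abs)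
qed

lemma ennreal_suminf_swap:
  fixes f :: "nat \<Rightarrow> nat \<Rightarrow> ennreal"
  shows "(\<Sum>i. \<Sum>j. f i j) = (\<Sum>j. \<Sum>i. f i j)"
proof -
  have "(\<Sum>i. \<Sum>j. f i j) = (\<integral>\<^sup>+i. \<integral>\<^sup>+j. case_prod f (i, j) \<partial>count_space UNIV \<partial>count_space UNIV)"
    unfolding nn_integral_count_space_nat prod.case ..
  also have "\<dots> = (\<integral>\<^sup>+j. \<integral>\<^sup>+i. case_prod f (i, j) \<partial>count_space UNIV \<partial>count_space UNIV)"
    unfolding nn_integral_fst_count_space nn_integral_snd_count_space ..
  also have "\<dots> = (\<Sum>j. \<Sum>i. f i j)"
    unfolding nn_integral_count_space_nat prod.case ..
  finally show ?thesis .
qed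

text \<open>Apply the triangle inequality to the inversion formula and sum over \<open>k\<close>: each binomial
  moment of order \<open>m\<close> is then counted \<open>(\<Sum>k. m choose k) = 2 ^ m\<close> times.\<close>

lemma sum_abs_le_binomial_moments:
  assumes u: "2 < u" "summable (\<lambda>k. \<bar>g k\<bar> * u ^ k)"
  shows "(\<Sum>k. ennreal \<bar>g k\<bar>) \<le> (\<Sum>m. ennreal (2 ^ m * \<bar>binomial_moment m g\<bar>))"
proof -
  have "ennreal \<bar>g k\<bar> \<le> (\<Sum>m. ennreal (real (m choose k) * \<bar>binomial_moment m g\<bar>))" for k
  proof -
    note inv = binomial_inversion[OF u, of k]
    have s: "summable (\<lambda>m. real (m choose k) * \<bar>binomial_moment m g\<bar>)"
      using inv(2) by (simp add: abs_mult)
    have "\<bar>g k\<bar> \<le> (\<Sum>m. \<bar>(- 1) ^ (m + k) * real (m choose k) * binomial_moment m g\<bar>)"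
      unfolding sums_unique[OF inv(1)] using s
      by (intro summable_rabs) (simp add: abs_mult power_abs)
    also have "\<dots> = (\<Sum>m. real (m choose k) * \<bar>binomial_moment m g\<bar>)"
      by (simp add: abs_mult power_abs)
    finally have "ennreal \<bar>g k\<bar> \<le> ennreal (\<Sum>m. real (m choose k) * \<bar>binomial_moment m g\<bar>)"
      by (rule ennreal_leI)
    also have "\<dots> = (\<Sum>m. ennreal (real (m choose k) * \<bar>binomial_moment m g\<bar>))"
      by (rule suminf_ennreal_eq[OF _ summable_sums[OF s], symmetric]) simp
    finally show ?thesis .
  qed
  then have "(\<Sum>k. ennreal \<bar>g k\<bar>) \<le> (\<Sum>k. \<Sum>m. ennreal (real (m choose k) * \<bar>binomial_moment m g\<bar>))"
    by (intro suminf_le) auto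
  also have "\<dots> = (\<Sum>m. \<Sum>k. ennreal (real (m choose k) * \<bar>binomial_moment m g\<bar>))"
    by (rule ennreal_suminf_swap)
  also have "\<dots> = (\<Sum>m. ennreal (2 ^ m * \<bar>binomial_moment m g\<bar>))"
  proof (rule suminf_cong)
    fix m
    have "(\<Sum>k. ennreal (real (m choose k) * \<bar>binomial_moment m g\<bar>))
        = (\<Sum>k\<le>m. ennreal (real (m choose k) * \<bar>binomial_moment m g\<bar>))"
      by (intro suminf_finite) (auto simp: binomial_eq_0)
    also have "\<dots> = ennreal ((\<Sum>k\<le>m. real (m choose k)) * \<bar>binomial_moment m g\<bar>)"
      by (simp add: sum_ennreal sum_distrib_right)
    also have "(\<Sum>k\<le>m. real (m choose k)) = 2 ^ m"
      using choose_row_sum[of m] by (simp flip: of_nat_sum)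
    finally show "(\<Sum>k. ennreal (real (m choose k) * \<bar>binomial_moment m g\<bar>))
        = ennreal (2 ^ m * \<bar>binomial_moment m g\<bar>)" .
  qed
  finally show ?thesis .
qed

text \<open>The bound of the \<open>l1\<close> norm by binomial moments, applied to \<open>g1 - g2\<close>.  The moment of
  order \<open>0\<close>, which the distance \<open>d2\<close> omits, vanishes because both functions have total mass \<open>1\<close>.\<close>

lemma d_tv_le_d2:
  assumes "g1 \<in> class_F2" "g2 \<in> class_F2"
  shows "d_tv g1 g2 \<le> d2 g1 g2"
proof -
  define g where "g k = g1 k - g2 k" for k
  obtain u1 where u1: "2 < u1" "summable (\<lambda>k. \<bar>g1 k\<bar> * u1 ^ k)"
    using assms(1) by (auto simp: class_F2_def)
  obtain u2 where u2: "2 < u2" "summable (\<lambda>k. \<bar>g2 k\<bar> * u2 ^ k)"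
    using assms(2) by (auto simp: class_F2_def)
  define u where "u = min u1 u2"
  have u: "2 < u" using u1 u2 by (simp add: u_def)
  have su: "summable (\<lambda>k. \<bar>g k\<bar> * u ^ k)"
  proof (rule summable_comparison_test')
    show "summable (\<lambda>k. \<bar>g1 k\<bar> * u1 ^ k + \<bar>g2 k\<bar> * u2 ^ k)"
      by (intro summable_add u1 u2)
    show "norm (\<bar>g k\<bar> * u ^ k) \<le> \<bar>g1 k\<bar> * u1 ^ k + \<bar>g2 k\<bar> * u2 ^ k" for k
    proof -
      have "\<bar>g k\<bar> * u ^ k \<le> (\<bar>g1 k\<bar> + \<bar>g2 k\<bar>) * u ^ k"
        using u by (intro mult_right_mono) (auto simp: g_def)
      also have "\<dots> \<le> \<bar>g1 k\<bar> * u1 ^ k + \<bar>g2 k\<bar> * u2 ^ k"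
        unfolding distrib_right using u
        by (intro add_mono mult_left_mono power_mono) (auto simp: u_def)
      finally show ?thesis using u by simp
    qed
  qed
  have diff: "binomial_moment m g = binomial_moment m g1 - binomial_moment m g2" for m
    unfolding binomial_moment_def g_def right_diff_distrib
    by (intro suminf_diff[symmetric] summable_rabs_cancel[OF summable_binomial_moment[OF u1]]
        summable_rabs_cancel[OF summable_binomial_moment[OF u2]])
  have "binomial_moment 0 g = 0"
    using assms unfolding diff by (auto simp: binomial_moment_def class_F2_def sums_iff)
  then have "(\<Sum>m. ennreal (2 ^ m * \<bar>binomial_moment m g\<bar>))
      = (\<Sum>m. ennreal (2 ^ Suc m * \<bar>binomial_moment (Suc m) g\<bar>))"
    by (subst suminf_offset[of _ 1]) (simp_all only: summableI, simp)
  moreover have "2 ^ m * \<bar>binomial_moment m g\<bar>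
      = 2 ^ m / fact m * \<bar>factorial_moment m g1 - factorial_moment m g2\<bar>" for m
    unfolding diff
    by (simp add: factorial_moment_eq_binomial_moment assms abs_mult flip: right_diff_distrib)
  ultimately have "(\<Sum>k. ennreal \<bar>g k\<bar>) \<le> (\<Sum>m. ennreal (2 ^ Suc m / fact (Suc m) *
        \<bar>factorial_moment (Suc m) g1 - factorial_moment (Suc m) g2\<bar>))"
    using sum_abs_le_binomial_moments[OF u su] by (simp only:)
  then show ?thesis
    unfolding d_tv_def d2_def g_def by (rule mult_left_mono) simp
qed

section \<open>Coefficientwise majorants of power series\<close>

text \<open>Coefficientwise domination is compatible with sums and products, so estimates of the single
  factors combine into estimates of the product, and evaluation at \<open>z = 2\<close> is postponed to the
  very end.\<close>

definition fps_majorized :: "real fps \<Rightarrow> real fps \<Rightarrow> bool" (infix "\<lless>" 50) where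
  "f \<lless> g \<longleftrightarrow> (\<forall>m. \<bar>f $ m\<bar> \<le> g $ m)"

lemma fps_majorized_add:
  assumes "f \<lless> g" "f' \<lless> g'"
  shows "f + f' \<lless> g + g'"
  unfolding fps_majorized_def
proof
  fix m
  have "\<bar>f $ m\<bar> \<le> g $ m" "\<bar>f' $ m\<bar> \<le> g' $ m"
    using assms by (auto simp: fps_majorized_def)
  then show "\<bar>(f + f') $ m\<bar> \<le> (g + g') $ m"
    unfolding fps_add_nth by linarith
qed

lemma fps_majorized_mult:
  assumes "f \<lless> g" "f' \<lless> g'"
  shows "f * f' \<lless> g * g'"
  unfolding fps_majorized_def
proof
  fix m
  have "\<bar>(f * f') $ m\<bar> \<le> (\<Sum>i = 0..m. \<bar>f $ i * f' $ (m - i)\<bar>)"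
    unfolding fps_mult_nth by (rule sum_abs)
  also have "\<dots> \<le> (\<Sum>i = 0..m. g $ i * g' $ (m - i))"
    unfolding abs_mult
  proof (intro sum_mono mult_mono)
    fix i
    show "\<bar>f $ i\<bar> \<le> g $ i" "\<bar>f' $ (m - i)\<bar> \<le> g' $ (m - i)"
      using assms by (auto simp: fps_majorized_def)
    then show "0 \<le> g $ i" by linarith
  qed simp
  finally show "\<bar>(f * f') $ m\<bar> \<le> (g * g') $ m"
    by (simp add: fps_mult_nth)
qed

lemma fps_majorized_refl_if_nonneg:
  "(\<And>m. 0 \<le> f $ m) \<Longrightarrow> f \<lless> f"
  by (simp add: fps_majorized_def)

lemma fps_majorized_le:
  "f \<lless> g \<Longrightarrow> (\<And>m. g $ m \<le> h $ m) \<Longrightarrow> f \<lless> h"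
  unfolding fps_majorized_def by (meson order_trans)

lemma power_monomial_times_fps_exp_nth:
  "(fps_const c * fps_X ^ k * fps_exp (p::real)) $ m =
    (if m < k then 0 else c * (p ^ (m - k) / fact (m - k)))"
  by (simp add: mult.assoc fps_X_power_mult_nth)

lemma linear_majorized_exp:
  assumes "0 \<le> (p::real)"
  shows "1 + fps_const p * fps_X \<lless> fps_exp p"
  unfolding fps_majorized_def
proof
  fix m :: nat
  consider "m = 0" | "m = 1" | "m \<ge> 2" by linarith
  then show "\<bar>(1 + fps_const p * fps_X) $ m\<bar> \<le> fps_exp p $ m"
    using assms by cases (auto simp: fps_X_nth)
qed

text \<open>The coefficient of \<open>z ^ (k + 2)\<close> on the left is \<open>- p ^ (k + 2) / (k + 2)!\<close>, and
  \<open>(k + 2)! \<ge> 2 k!\<close>.\<close>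

lemma linear_minus_exp_majorized:
  assumes "0 \<le> (p::real)"
  shows "1 + fps_const p * fps_X - fps_exp p \<lless> fps_const (p\<^sup>2 / 2) * fps_X ^ 2 * fps_exp p"
  unfolding fps_majorized_def
proof
  fix m :: nat
  consider "m = 0" | "m = 1" | k where "m = k + 2"
    by (metis One_nat_def Suc_1 add.commute add_2_eq_Suc' not0_implies_Suc)
  then show "\<bar>(1 + fps_const p * fps_X - fps_exp p) $ m\<bar>
      \<le> (fps_const (p\<^sup>2 / 2) * fps_X ^ 2 * fps_exp p) $ m"
  proof cases
    case 3
    have fact2: "fact (k + 2) = (real k + 2) * ((real k + 1) * fact k)"
      by (simp add: algebra_simps)
    have "2 \<le> (real k + 1) * (real k + 2)"
      using mult_mono[of 1 "real k + 1" 2 "real k + 2"] by simp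
    then have "p ^ m / ((real k + 2) * ((real k + 1) * fact k)) \<le> p ^ m / (2 * fact k)"
      using assms by (intro divide_left_mono) (auto simp: mult_ac)
    moreover have "(1 + fps_const p * fps_X - fps_exp p) $ m
        = - (p ^ m / ((real k + 2) * ((real k + 1) * fact k)))"
      using 3 by (simp add: fps_X_nth fact2 del: add_2_eq_Suc' fact_Suc)
    moreover have "(fps_const (p\<^sup>2 / 2) * fps_X ^ 2 * fps_exp p) $ m = p ^ m / (2 * fact k)"
      unfolding power_monomial_times_fps_exp_nth using 3 by (simp add: power2_eq_square)
    ultimately show ?thesis
      using assms by simp
  qed (use assms in \<open>simp_all add: power_monomial_times_fps_exp_nth fps_X_nth\<close>)
qed

text \<open>The quadratic correction cancels the coefficients up to order \<open>2\<close>.  For \<open>m \<ge> 3\<close> the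
  comparison of coefficients reads \<open>m (m - 1) / 2 - 1 \<le> m (m - 1) (m - 2) / 3\<close>, which amounts to
  \<open>0 \<le> (2 m + 1) (m - 3)\<close>.  There is equality at \<open>m = 3\<close>, so the constant \<open>1 / 3\<close>, the source
  of \<open>4 / 3\<close> in the final bound, cannot be lowered in a majorant of this form.\<close>

lemma linear_minus_second_order_exp_majorized:
  assumes "0 \<le> (p::real)"
  shows "1 + fps_const p * fps_X - fps_exp p + fps_const (p\<^sup>2 / 2) * fps_X ^ 2 * fps_exp p
    \<lless> fps_const (p ^ 3 / 3) * fps_X ^ 3 * fps_exp p"
  unfolding fps_majorized_def
proof
  fix m :: nat
  consider "m = 0" | "m = 1" | "m = 2" | k where "m = k + 3"
    by (metis One_nat_def Suc_1 add.commute add_2_eq_Suc' not0_implies_Suc numeral_3_eq_3 add_Suc_right)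
  then show "\<bar>(1 + fps_const p * fps_X - fps_exp p + fps_const (p\<^sup>2 / 2) * fps_X ^ 2 * fps_exp p) $ m\<bar>
      \<le> (fps_const (p ^ 3 / 3) * fps_X ^ 3 * fps_exp p) $ m"
  proof cases
    case (4 k)
    define d where "d = (real k + 1) * (real k + 2) * (real k + 3)"
    have d: "d > 0" by (simp add: d_def)
    have f1: "fact (Suc k) = (real k + 1) * fact k" by simp
    have f3: "fact (k + 3) = d * fact k"
      by (simp add: d_def numeral_3_eq_3 algebra_simps)
    have eq: "(1 + fps_const p * fps_X - fps_exp p + fps_const (p\<^sup>2 / 2) * fps_X ^ 2 * fps_exp p) $ m
        = p ^ (k + 3) / fact k * (1 / (2 * (real k + 1)) - 1 / d)"
      using 4 unfolding fps_add_nth fps_sub_nth power_monomial_times_fps_exp_nth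
      using d by (simp add: fps_X_nth f1 f3 power_add power2_eq_square power3_eq_cube
          right_diff_distrib mult_ac del: fact_Suc)
    have "1 / (2 * (real k + 1)) - 1 / d = ((real k + 2) * (real k + 3) - 2) / (2 * d)"
    proof -
      have "1 / (2 * (real k + 1)) = (real k + 2) * (real k + 3) / (2 * d)"
        by (simp add: d_def)
      then show ?thesis using d by (simp add: diff_divide_distrib)
    qed
    moreover have "((real k + 2) * (real k + 3) - 2) \<le> 2 * d / 3"
      by (simp add: d_def field_simps)
    moreover have "0 \<le> ((real k + 2) * (real k + 3) - 2)"
      by (simp add: field_simps)
    ultimately have "0 \<le> 1 / (2 * (real k + 1)) - 1 / d" "1 / (2 * (real k + 1)) - 1 / d \<le> 1 / 3"
      using d by (simp_all only:) (simp_all add: divide_simps)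
    then have "\<bar>p ^ (k + 3) / fact k * (1 / (2 * (real k + 1)) - 1 / d)\<bar> \<le> p ^ (k + 3) / fact k * (1 / 3)"
      using assms by (simp only: abs_mult) (intro mult_mono, auto)
    then show ?thesis
      unfolding eq power_monomial_times_fps_exp_nth using 4
      by (simp add: power_add mult_ac)
  next
    case 3
    then show ?thesis
      unfolding fps_add_nth fps_sub_nth power_monomial_times_fps_exp_nth by (simp add: fps_X_nth)
  qed (use assms in \<open>simp_all add: power_monomial_times_fps_exp_nth fps_X_nth\<close>)
qed

lemma prod_linear_majorized_exp:
  assumes "finite A" "\<And>i. i \<in> A \<Longrightarrow> 0 \<le> (p i::real)"
  shows "(\<Prod>i\<in>A. 1 + fps_const (p i) * fps_X) \<lless> fps_exp (\<Sum>i\<in>A. p i)"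
  using assms
proof (induction A rule: finite_induct)
  case empty
  then show ?case by (simp add: fps_majorized_def)
next
  case (insert a A)
  then show ?case
    using fps_majorized_mult[OF linear_majorized_exp[of "p a"] insert.IH]
    by (simp add: fps_exp_add_mult)
qed

text \<open>First-order comparison: when a factor is added, the error changes according to
  \<open>x F - b G = (x - b) F + b (F - G)\<close>, where \<open>F \<lless> G\<close> by the preceding lemma.\<close>

lemma prod_linear_minus_exp_majorized:
  assumes "finite A" "\<And>i. i \<in> A \<Longrightarrow> 0 \<le> (p i::real)"
  shows "(\<Prod>i\<in>A. 1 + fps_const (p i) * fps_X) - fps_exp (\<Sum>i\<in>A. p i)
    \<lless> fps_const ((\<Sum>i\<in>A. (p i)\<^sup>2) / 2) * fps_X ^ 2 * fps_exp (\<Sum>i\<in>A. p i)"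
  using assms
proof (induction A rule: finite_induct)
  case empty
  then show ?case by (simp add: fps_majorized_def)
next
  case (insert a A)
  define F where "F = (\<Prod>i\<in>A. 1 + fps_const (p i) * fps_X)"
  define G where "G = fps_exp (\<Sum>i\<in>A. p i)"
  define b where "b = fps_exp (p a)"
  define c where "c = (\<Sum>i\<in>A. (p i)\<^sup>2)"
  have p: "0 \<le> p a" using insert.prems by auto
  have b: "b \<lless> b"
    unfolding b_def using p by (intro fps_majorized_refl_if_nonneg) simp
  have "(1 + fps_const (p a) * fps_X - b) * F + b * (F - G) \<lless>
      fps_const ((p a)\<^sup>2 / 2) * fps_X ^ 2 * b * G + b * (fps_const (c / 2) * fps_X ^ 2 * G)"
    using insert.IH insert.prems linear_minus_exp_majorized[OF p]
      prod_linear_majorized_exp[OF insert.hyps(1), of p]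
    unfolding F_def[symmetric] G_def[symmetric] b_def[symmetric] c_def[symmetric]
    by (intro fps_majorized_add fps_majorized_mult b) auto
  moreover have "(1 + fps_const (p a) * fps_X - b) * F + b * (F - G)
      = (1 + fps_const (p a) * fps_X) * F - b * G"
    by (simp add: algebra_simps)
  moreover have "fps_const ((p a)\<^sup>2 / 2) * fps_X ^ 2 * b * G + b * (fps_const (c / 2) * fps_X ^ 2 * G)
      = fps_const (((p a)\<^sup>2 + c) / 2) * fps_X ^ 2 * (b * G)"
    by (simp add: add_divide_distrib algebra_simps flip: fps_const_add)
  ultimately show ?case
    using insert.hyps by (simp add: F_def G_def b_def c_def fps_exp_add_mult)
qed

text \<open>Write \<open>x = 1 + p z\<close> and \<open>b = e ^ (p z)\<close> for a new factor and its exponential,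
  \<open>y = p\<^sup>2 z\<^sup>2 / 2\<close> for its quadratic correction, and \<open>F\<close>, \<open>G\<close>, \<open>w\<close> for the product, the
  exponential and the correction accumulated so far.  The new error splits as
  \<open>x F - (1 - (y + w)) (b G) = (x - b + y b) F + y b (G - F) + b (F - (1 - w) G)\<close>.
  The first term is the second-order error of one factor, the second the first-order error of the
  old ones multiplied by the new correction, and the third is the old error.  The terms of order 4
  add up to \<open>c2\<^sup>2 / 8 + p\<^sup>2 c2 / 4\<close>, which is part of the square \<open>(p\<^sup>2 + c2)\<^sup>2 / 8\<close>.\<close>

lemma prod_linear_second_order_majorized:
  assumes "finite A" "\<And>i. i \<in> A \<Longrightarrow> 0 \<le> (p i::real)"
  shows "(\<Prod>i\<in>A. 1 + fps_const (p i) * fps_X)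
      - (1 - fps_const ((\<Sum>i\<in>A. (p i)\<^sup>2) / 2) * fps_X ^ 2) * fps_exp (\<Sum>i\<in>A. p i)
    \<lless> fps_const ((\<Sum>i\<in>A. p i ^ 3) / 3) * fps_X ^ 3 * fps_exp (\<Sum>i\<in>A. p i)
      + fps_const ((\<Sum>i\<in>A. (p i)\<^sup>2)\<^sup>2 / 8) * fps_X ^ 4 * fps_exp (\<Sum>i\<in>A. p i)"
  using assms
proof (induction A rule: finite_induct)
  case empty
  then show ?case by (simp add: fps_majorized_def)
next
  case (insert a A)
  define F where "F = (\<Prod>i\<in>A. 1 + fps_const (p i) * fps_X)"
  define G where "G = fps_exp (\<Sum>i\<in>A. p i)"
  define b where "b = fps_exp (p a)"
  define c2 where "c2 = (\<Sum>i\<in>A. (p i)\<^sup>2)"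
  define c3 where "c3 = (\<Sum>i\<in>A. p i ^ 3)"
  define x where "x = 1 + fps_const (p a) * fps_X"
  define y where "y = fps_const ((p a)\<^sup>2 / 2) * fps_X ^ 2"
  define w where "w = fps_const (c2 / 2) * fps_X ^ 2"
  have p: "0 \<le> p a" using insert.prems by auto
  have b: "b \<lless> b"
    unfolding b_def using p by (intro fps_majorized_refl_if_nonneg) simp
  have y: "y * b \<lless> y * b"
    by (rule fps_majorized_refl_if_nonneg)
      (use p in \<open>simp add: b_def y_def power_monomial_times_fps_exp_nth\<close>)
  have "(x - b + y * b) * F + y * b * - (F - G) + b * (F - (1 - w) * G) \<lless>
      fps_const (p a ^ 3 / 3) * fps_X ^ 3 * b * G + y * b * (w * G)
      + b * (fps_const (c3 / 3) * fps_X ^ 3 * G + fps_const (c2\<^sup>2 / 8) * fps_X ^ 4 * G)"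
  proof (intro fps_majorized_add fps_majorized_mult[of "x - b + y * b" _ F G] fps_majorized_mult[OF y] fps_majorized_mult[OF b])
    show "x - b + y * b \<lless> fps_const (p a ^ 3 / 3) * fps_X ^ 3 * b"
      using linear_minus_second_order_exp_majorized[OF p] by (simp add: x_def y_def b_def)
    show "F \<lless> G"
      using insert by (simp add: F_def G_def prod_linear_majorized_exp)
    show "- (F - G) \<lless> w * G"
      using prod_linear_minus_exp_majorized[OF insert.hyps(1), of p] insert.prems
      by (simp add: F_def G_def w_def c2_def fps_majorized_def abs_minus_commute)
    show "F - (1 - w) * G \<lless> fps_const (c3 / 3) * fps_X ^ 3 * G + fps_const (c2\<^sup>2 / 8) * fps_X ^ 4 * G"
      using insert by (simp add: F_def G_def w_def c2_def c3_def)
  qed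
  also have "(x - b + y * b) * F + y * b * - (F - G) + b * (F - (1 - w) * G)
      = x * F - (1 - (y + w)) * (b * G)"
    by (simp add: algebra_simps)
  also have "y + w = fps_const (((p a)\<^sup>2 + c2) / 2) * fps_X ^ 2"
    by (simp add: y_def w_def add_divide_distrib algebra_simps flip: fps_const_add)
  also have "fps_const (p a ^ 3 / 3) * fps_X ^ 3 * b * G + y * b * (w * G)
      + b * (fps_const (c3 / 3) * fps_X ^ 3 * G + fps_const (c2\<^sup>2 / 8) * fps_X ^ 4 * G)
     = fps_const ((p a ^ 3 + c3) / 3) * fps_X ^ 3 * (b * G)
      + fps_const ((p a)\<^sup>2 * c2 / 4 + c2\<^sup>2 / 8) * fps_X ^ 4 * (b * G)"
  proof -
    have "fps_X ^ 4 = (fps_X ^ 2 * fps_X ^ 2 :: real fps)" by (simp flip: power_add)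
    moreover have "fps_const ((p a)\<^sup>2 * c2 / 4) = fps_const ((p a)\<^sup>2 / 2) * fps_const (c2 / 2)"
      by (simp add: field_simps)
    ultimately show ?thesis
      unfolding y_def w_def fps_const_add[symmetric] add_divide_distrib
      by (simp add: algebra_simps del: fps_const_mult fps_const_add)
  qed
  finally have step: "x * F - (1 - fps_const (((p a)\<^sup>2 + c2) / 2) * fps_X ^ 2) * (b * G) \<lless>
      fps_const ((p a ^ 3 + c3) / 3) * fps_X ^ 3 * (b * G)
      + fps_const ((p a)\<^sup>2 * c2 / 4 + c2\<^sup>2 / 8) * fps_X ^ 4 * (b * G)" .
  have G: "b * G = fps_exp (p a + (\<Sum>i\<in>A. p i))"
    by (simp add: b_def G_def fps_exp_add_mult)
  have s: "0 \<le> p a + (\<Sum>i\<in>A. p i)"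
    using insert.prems by (intro add_nonneg_nonneg sum_nonneg) auto
  have c: "(p a)\<^sup>2 * c2 / 4 + c2\<^sup>2 / 8 \<le> ((p a)\<^sup>2 + c2)\<^sup>2 / 8"
    using zero_le_power2[of "(p a)\<^sup>2"] by (simp add: power2_sum field_simps)
  have coeffs: "(fps_const ((p a ^ 3 + c3) / 3) * fps_X ^ 3 * (b * G)
        + fps_const ((p a)\<^sup>2 * c2 / 4 + c2\<^sup>2 / 8) * fps_X ^ 4 * (b * G)) $ m
      \<le> (fps_const ((p a ^ 3 + c3) / 3) * fps_X ^ 3 * (b * G)
        + fps_const (((p a)\<^sup>2 + c2)\<^sup>2 / 8) * fps_X ^ 4 * (b * G)) $ m" for m
    using mult_right_mono[OF c, of "(p a + (\<Sum>i\<in>A. p i)) ^ (m - 4) / fact (m - 4)"] s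
    unfolding G fps_add_nth power_monomial_times_fps_exp_nth by (intro add_left_mono) simp
  have "x * F - (1 - fps_const (((p a)\<^sup>2 + c2) / 2) * fps_X ^ 2) * (b * G) \<lless>
      fps_const ((p a ^ 3 + c3) / 3) * fps_X ^ 3 * (b * G)
      + fps_const (((p a)\<^sup>2 + c2)\<^sup>2 / 8) * fps_X ^ 4 * (b * G)"
    by (rule fps_majorized_le[OF step coeffs])
  then show ?case
    using insert.hyps by (simp add: F_def G x_def c2_def c3_def)
qed

section \<open>Binomial moments of the two functions\<close>

text \<open>After the shift by \<open>m\<close>, the binomial coefficient turns the Poisson weight at \<open>k + m\<close> into
  \<open>\<lambda> ^ m / m!\<close> times the Poisson weight at \<open>k\<close>, and the remaining factor is a quadratic polynomial
  in \<open>k\<close>, whose Poisson expectation is explicit.\<close>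

lemma phi2_binomial_moment:
  assumes "power_sum n p 1 > 0"
  shows "binomial_moment m (phi2 n p)
    = ((1 - fps_const (power_sum n p 2 / 2) * fps_X ^ 2) * fps_exp (power_sum n p 1)) $ m"
proof -
  define l where "l = power_sum n p 1"
  define c where "c = power_sum n p 2"
  define d where "d = c / (2 * l\<^sup>2)"
  have l: "l > 0" using assms by (simp add: l_def)
  have phi: "phi2 n p k = exp (- l) * (l ^ k / fact k) * (1 - d * ((real k - l)\<^sup>2 - real k))" for k
    unfolding phi2_def Let_def l_def[symmetric] d_def c_def ..
  \<comment> \<open>The coefficients, in the basis \<open>k (k - 1)\<close>, \<open>k\<close>, \<open>1\<close>, of the quadratic factor of \<open>phi2\<close> at \<open>k + m\<close>.\<close>
  define a where "a = - d"
  define b where "b = - d * (2 * real m - 2 * l)"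
  define e where "e = 1 - d * (real m * (real m - 1) - 2 * l * real m + l\<^sup>2)"
  have choose: "real ((k + m) choose m) * (l ^ (k + m) / fact (k + m)) = l ^ m / fact m * (l ^ k / fact k)" for k
    by (simp add: binomial_fact power_add)
  have shifted: "real ((k + m) choose m) * phi2 n p (k + m) = exp (- l) * (l ^ m / fact m) *
      (l ^ k / fact k * (a * (real k * (real k - 1)) + b * real k + e))" for k
  proof -
    have "1 - d * ((real (k + m) - l)\<^sup>2 - real (k + m)) = a * (real k * (real k - 1)) + b * real k + e"
      by (simp add: a_def b_def e_def power2_eq_square algebra_simps)
    then have "real ((k + m) choose m) * phi2 n p (k + m)
        = exp (- l) * (real ((k + m) choose m) * (l ^ (k + m) / fact (k + m))) *
          (a * (real k * (real k - 1)) + b * real k + e)"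
      unfolding phi by (simp only: mult_ac)
    then show ?thesis unfolding choose by (simp only: mult_ac)
  qed
  have "(\<lambda>k. real ((k + m) choose m) * phi2 n p (k + m)) sums
      (exp (- l) * (l ^ m / fact m) * ((a * l\<^sup>2 + b * l + e) * exp l))"
    unfolding shifted by (intro sums_mult exp_moment_sums)
  moreover have "a * l\<^sup>2 + b * l + e = 1 - d * (real m * (real m - 1))"
    by (simp add: a_def b_def e_def power2_eq_square algebra_simps)
  moreover have "exp (- l) * (l ^ m / fact m) * ((1 - d * (real m * (real m - 1))) * exp l)
      = l ^ m / fact m * (1 - d * (real m * (real m - 1)))"
    by (simp add: exp_minus field_simps)
  ultimately have "(\<lambda>k. real ((k + m) choose m) * phi2 n p (k + m)) sums
      (l ^ m / fact m * (1 - d * (real m * (real m - 1))))"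
    by (simp only:)
  then have "(\<lambda>k. real (k choose m) * phi2 n p k) sums
      (l ^ m / fact m * (1 - d * (real m * (real m - 1))))"
    by (subst (asm) sums_zero_iff_shift) (simp_all add: binomial_eq_0)
  then have "binomial_moment m (phi2 n p) = l ^ m / fact m * (1 - d * (real m * (real m - 1)))"
    by (simp add: binomial_moment_def sums_iff)
  also have "\<dots> = ((1 - fps_const (c / 2) * fps_X ^ 2) * fps_exp l) $ m"
  proof -
    consider "m = 0" | "m = 1" | k where "m = Suc (Suc k)"
      by (metis One_nat_def not0_implies_Suc)
    then show ?thesis
    proof cases
      case 3
      have "fact m = real m * (real m - 1) * fact k"
        unfolding 3 by (simp add: algebra_simps)
      moreover have "real m * (real m - 1) \<noteq> 0" unfolding 3 by simp
      ultimately have "l ^ m / fact m * (real m * (real m - 1)) = l\<^sup>2 * (l ^ k / fact k)"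
        unfolding 3 by (simp add: power2_eq_square)
      then have "l ^ m / fact m * (1 - d * (real m * (real m - 1)))
          = l ^ m / fact m - d * (l\<^sup>2 * (l ^ k / fact k))"
        by (simp only: right_diff_distrib[of _ 1] mult_1_right mult.left_commute[of _ d])
      moreover have "d * (l\<^sup>2 * (l ^ k / fact k)) = c / 2 * (l ^ k / fact k)"
        using l by (simp add: d_def)
      ultimately have "l ^ m / fact m * (1 - d * (real m * (real m - 1)))
          = l ^ m / fact m - c / 2 * (l ^ k / fact k)"
        by (simp only:)
      moreover have "((1 - fps_const (c / 2) * fps_X ^ 2) * fps_exp l) $ m
          = l ^ m / fact m - c / 2 * (l ^ k / fact k)"
      proof -
        have "\<not> m < 2" "m - 2 = k" using 3 by simp_all
        then show ?thesis
          unfolding left_diff_distrib fps_sub_nth power_monomial_times_fps_exp_nth by simp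
      qed
      ultimately show ?thesis by (simp only:)
    qed (simp_all add: left_diff_distrib power_monomial_times_fps_exp_nth)
  qed
  finally show ?thesis by (simp add: l_def c_def)
qed

text \<open>Both sides are coefficients of the polynomial \<open>E (1 + z) ^ S_n\<close>: expanding over the values
  of \<open>S_n\<close> gives the binomial moments, and independence gives the product.\<close>

lemma (in prob_space) binomial_moment_indicator_sum:
  assumes ind: "indep_vars (\<lambda>_. count_space UNIV) I {1..n}"
    and val: "\<And>i x. i \<in> {1..n} \<Longrightarrow> x \<in> space M \<Longrightarrow> I i x \<in> {0, 1}"
    and p: "\<And>i. i \<in> {1..n} \<Longrightarrow> p i = prob {x \<in> space M. I i x = 1}"
  shows "binomial_moment m (sum_mass M n I) = (\<Prod>i\<in>{1..n}. 1 + fps_const (p i) * fps_X) $ m"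
proof -
  define S where "S x = (\<Sum>i = 1..n. I i x)" for x
  have meas: "I i \<in> measurable M (count_space UNIV)" if "i \<in> {1..n}" for i
    using ind that by (auto simp: indep_vars_def)
  have S: "S \<in> measurable M (count_space UNIV)"
    unfolding S_def using meas by (intro measurable_sum_nat) auto
  have le: "S x \<le> n" if "x \<in> space M" for x
  proof -
    have "S x \<le> (\<Sum>i = 1..n. 1)"
      unfolding S_def using val that by (intro sum_mono) fastforce
    then show ?thesis by simp
  qed
  have mass: "sum_mass M n I k = prob {x \<in> space M. S x = k}" for k
    by (simp add: sum_mass_def S_def)
  have ev: "{x \<in> space M. S x = k} \<in> events" for k
    using measurable_sets[OF S, of "{k}"] by (simp add: vimage_def Int_def conj_commute)
  have mass0: "sum_mass M n I k = 0" if "k \<notin> {..n}" for k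
  proof -
    have "{x \<in> space M. S x = k} = {}" using le that by auto
    then show ?thesis by (simp only: mass measure_empty)
  qed
  have "(\<Sum>k\<le>n. sum_mass M n I k * (1 + z) ^ k) = (\<Prod>i\<in>{1..n}. 1 + p i * z)" for z :: real
  proof -
    have "expectation (\<lambda>x. (1 + z) ^ S x)
        = expectation (\<lambda>x. \<Sum>k\<le>n. indicator {x \<in> space M. S x = k} x * (1 + z) ^ k)"
      using le by (intro Bochner_Integration.integral_cong) (auto simp: indicator_def if_distrib cong: if_cong)
    also have "\<dots> = (\<Sum>k\<le>n. sum_mass M n I k * (1 + z) ^ k)"
      using ev by (subst Bochner_Integration.integral_sum) (auto simp: mass less_top[symmetric])
    finally have "(\<Sum>k\<le>n. sum_mass M n I k * (1 + z) ^ k) = expectation (\<lambda>x. (1 + z) ^ S x)" ..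
    also have "\<dots> = expectation (\<lambda>x. \<Prod>i\<in>{1..n}. (1 + z) ^ I i x)"
      by (simp add: S_def power_sum)
    also have "\<dots> = (\<Prod>i\<in>{1..n}. expectation (\<lambda>x. (1 + z) ^ I i x))"
    proof (rule indep_vars_lebesgue_integral)
      show "indep_vars (\<lambda>_. borel) (\<lambda>i x. (1 + z) ^ I i x) {1..n}"
        using indep_vars_compose2[OF ind, of "\<lambda>_ k. (1 + z) ^ k" "\<lambda>_. borel"] by simp
      show "integrable M (\<lambda>x. (1 + z) ^ I i x)" if "i \<in> {1..n}" for i
      proof (rule integrable_const_bound[where B = "max 1 \<bar>1 + z\<bar>"])
        show "AE x in M. norm ((1 + z) ^ I i x) \<le> max 1 \<bar>1 + z\<bar>"
          using val[OF that] by (intro AE_I2) fastforce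
        show "(\<lambda>x. (1 + z) ^ I i x) \<in> borel_measurable M"
          using measurable_compose[OF meas[OF that], of "\<lambda>k. (1 + z) ^ k" borel] by simp
      qed
    qed simp
    also have "\<dots> = (\<Prod>i\<in>{1..n}. 1 + p i * z)"
    proof (rule prod.cong[OF refl])
      fix i assume i: "i \<in> {1..n}"
      have e: "{x \<in> space M. I i x = 1} \<in> events"
        using measurable_sets[OF meas[OF i], of "{1}"] by (simp add: vimage_def Int_def conj_commute)
      have "expectation (\<lambda>x. (1 + z) ^ I i x)
          = expectation (\<lambda>x. 1 + indicator {x \<in> space M. I i x = 1} x * z)"
      proof (rule Bochner_Integration.integral_cong[OF refl])
        fix x assume x: "x \<in> space M"
        then have "I i x = 0 \<or> I i x = 1" using val[OF i x] by simp
        then show "(1 + z) ^ I i x = 1 + indicator {x \<in> space M. I i x = 1} x * z"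
          using x by auto
      qed
      also have "\<dots> = 1 + p i * z"
        using e by (simp add: p[OF i] prob_space less_top[symmetric])
      finally show "expectation (\<lambda>x. (1 + z) ^ I i x) = 1 + p i * z" .
    qed
    finally show ?thesis .
  qed
  then have "poly (\<Sum>k\<le>n. smult (sum_mass M n I k) ([:1, 1:] ^ k)) = poly (\<Prod>i\<in>{1..n}. [:1, p i:])"
    by (intro ext) (simp add: poly_sum poly_prod mult.commute)
  then have polys: "(\<Sum>k\<le>n. smult (sum_mass M n I k) ([:1, 1:] ^ k)) = (\<Prod>i\<in>{1..n}. [:1, p i:])"
    by (simp only: poly_eq_poly_eq_iff)
  have coeff: "coeff ([:1, 1:] ^ k) m = real (k choose m)" for k
  proof (cases "m \<le> k")
    case False
    then have "degree ([:1, 1 :: real:] ^ k) < m"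
      by (simp add: degree_power_eq)
    then show ?thesis using False by (simp add: coeff_eq_0 binomial_eq_0)
  qed (simp add: coeff_linear_poly_power)
  have "binomial_moment m (sum_mass M n I) = (\<Sum>k\<le>n. real (k choose m) * sum_mass M n I k)"
    unfolding binomial_moment_def using mass0 by (intro suminf_finite) auto
  also have "\<dots> = coeff (\<Sum>k\<le>n. smult (sum_mass M n I k) ([:1, 1:] ^ k)) m"
    by (simp add: coeff_sum coeff mult.commute)
  also have "\<dots> = fps_of_poly (\<Prod>i\<in>{1..n}. [:1, p i:]) $ m"
    by (simp add: polys)
  also have "fps_of_poly (\<Prod>i\<in>{1..n}. [:1, p i:]) = (\<Prod>i\<in>{1..n}. 1 + fps_const (p i) * fps_X)"
    by (simp add: fps_of_poly_prod fps_of_poly_pCons)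
  finally show ?thesis .
qed

section \<open>The bound on the factorial moment distance\<close>

lemma power_monomial_times_fps_exp_sums:
  "(\<lambda>m. 2 ^ m * (fps_const c * fps_X ^ k * fps_exp x) $ m) sums (c * 2 ^ k * exp (2 * x :: real))"
proof -
  have "(\<lambda>m. c * 2 ^ k * ((2 * x) ^ m / fact m)) sums (c * 2 ^ k * exp (2 * x))"
    using exp_converges[of "2 * x"] by (intro sums_mult) (simp add: field_simps)
  moreover have "c * 2 ^ k * ((2 * x) ^ m / fact m)
      = 2 ^ (m + k) * (fps_const c * fps_X ^ k * fps_exp x) $ (m + k)" for m
    unfolding power_monomial_times_fps_exp_nth by (simp add: power_add power_mult_distrib)
  ultimately have "(\<lambda>m. 2 ^ (m + k) * (fps_const c * fps_X ^ k * fps_exp x) $ (m + k))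
      sums (c * 2 ^ k * exp (2 * x))"
    by (simp only:)
  then show ?thesis
    by (subst (asm) sums_zero_iff_shift) (simp_all add: power_monomial_times_fps_exp_nth)
qed

text \<open>The coefficients of the two power series are the binomial moments, so \<open>d2\<close> is at most half
  the value at \<open>2\<close> of a majorant of their difference.\<close>

lemma d2_le_of_majorized:
  assumes F2: "g1 \<in> class_F2" "g2 \<in> class_F2"
    and maj: "Abs_fps (\<lambda>m. binomial_moment m g1) - Abs_fps (\<lambda>m. binomial_moment m g2) \<lless> h"
    and h: "(\<lambda>m. 2 ^ m * h $ m) sums s"
  shows "d2 g1 g2 \<le> ennreal (s / 2)"
proof -
  have le: "\<bar>binomial_moment m g1 - binomial_moment m g2\<bar> \<le> h $ m" for m
    using maj by (simp add: fps_majorized_def)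
  then have nonneg: "0 \<le> h $ m" for m
    by (meson abs_ge_zero order_trans)
  have "(\<lambda>m. 2 ^ Suc m * h $ Suc m) sums (s - h $ 0)"
    using h by (subst sums_Suc_iff) simp
  have "2 ^ m / fact m * \<bar>factorial_moment m g1 - factorial_moment m g2\<bar> \<le> 2 ^ m * h $ m" for m
    using le[of m]
    by (simp add: factorial_moment_eq_binomial_moment F2 abs_mult flip: right_diff_distrib)
  then have "(\<Sum>m. ennreal (2 ^ Suc m / fact (Suc m) *
        \<bar>factorial_moment (Suc m) g1 - factorial_moment (Suc m) g2\<bar>))
      \<le> (\<Sum>m. ennreal (2 ^ Suc m * h $ Suc m))"
    by (intro suminf_le summableI ennreal_leI)
  also have "\<dots> = ennreal (s - h $ 0)"
    by (rule suminf_ennreal_eq) (use nonneg in simp, fact)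
  also have "\<dots> \<le> ennreal s"
    using nonneg by (intro ennreal_leI) simp
  finally have "d2 g1 g2 \<le> ennreal (1 / 2) * ennreal s"
    unfolding d2_def by (rule mult_left_mono) simp
  also have "\<dots> = ennreal (s / 2)"
    by (subst ennreal_mult'[symmetric]) auto
  finally show ?thesis .
qed

text \<open>Cauchy-Schwarz for the factorization \<open>p\<^sup>2 = p powr (1 / 2) * p powr (3 / 2)\<close>.\<close>

lemma sum_squares_squared_le:
  fixes p :: "'i \<Rightarrow> real"
  assumes "\<And>i. i \<in> A \<Longrightarrow> 0 \<le> p i"
  shows "(\<Sum>i\<in>A. p i ^ 2)\<^sup>2 \<le> (\<Sum>i\<in>A. p i) * (\<Sum>i\<in>A. p i ^ 3)"
proof -
  have "(\<Sum>i\<in>A. sqrt (p i) * (p i * sqrt (p i)))\<^sup>2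
      \<le> (\<Sum>i\<in>A. (sqrt (p i))\<^sup>2) * (\<Sum>i\<in>A. (p i * sqrt (p i))\<^sup>2)"
    by (rule Cauchy_Schwarz_ineq_sum)
  moreover have "(\<Sum>i\<in>A. sqrt (p i) * (p i * sqrt (p i))) = (\<Sum>i\<in>A. p i ^ 2)"
    using assms by (intro sum.cong) (simp_all add: power2_eq_square)
  moreover have "(\<Sum>i\<in>A. (sqrt (p i))\<^sup>2) = (\<Sum>i\<in>A. p i)"
    using assms by (intro sum.cong) simp_all
  moreover have "(\<Sum>i\<in>A. (p i * sqrt (p i))\<^sup>2) = (\<Sum>i\<in>A. p i ^ 3)"
    using assms by (intro sum.cong) (simp_all add: power_mult_distrib power2_eq_square power3_eq_cube)
  ultimately show ?thesis by simp
qed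

theorem theorem3p1:
  fixes M :: "'a measure" and n :: nat and I :: "nat \<Rightarrow> 'a \<Rightarrow> nat" and p :: "nat \<Rightarrow> real"
  assumes "prob_space M"
    and "n \<ge> 1"
    and "prob_space.indep_vars M (\<lambda>_. count_space UNIV) I {1..n}"
    and "\<And>i x. i \<in> {1..n} \<Longrightarrow> x \<in> space M \<Longrightarrow> I i x \<in> {0, 1}"
    and "\<And>i. i \<in> {1..n} \<Longrightarrow> p i = measure M {x \<in> space M. I i x = 1}"
    and "power_sum n p 1 > 0"
  shows "d_tv (sum_mass M n I) (phi2 n p) \<le> d2 (sum_mass M n I) (phi2 n p)
    \<and> d2 (sum_mass M n I) (phi2 n p)
        \<le> ennreal ((4 / 3 * power_sum n p 3 + (power_sum n p 2)\<^sup>2) * exp (2 * power_sum n p 1))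
    \<and> (4 / 3 * power_sum n p 3 + (power_sum n p 2)\<^sup>2) * exp (2 * power_sum n p 1)
        \<le> (4 / 3 + power_sum n p 1) * exp (2 * power_sum n p 1) * (\<Sum>i = 1..n. p i ^ 3)"
proof (intro conjI)
  interpret prob_space M by fact
  define l where "l = power_sum n p 1"
  define c2 where "c2 = power_sum n p 2"
  define c3 where "c3 = power_sum n p 3"
  note sums = l_def c2_def c3_def power_sum_def
  have p: "0 \<le> p i" if "i \<in> {1..n}" for i
    using assms(5)[OF that] by simp
  have meas: "I i \<in> measurable M (count_space UNIV)" if "i \<in> {1..n}" for i
    using assms(3) that by (auto simp: indep_vars_def)
  have f: "sum_mass M n I \<in> class_F2"
    using assms(1,4) meas by (intro sum_mass_in_class_F2) auto
  have phi: "phi2 n p \<in> class_F2"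
    using assms(6) by (rule phi2_in_class_F2)
  show "d_tv (sum_mass M n I) (phi2 n p) \<le> d2 (sum_mass M n I) (phi2 n p)"
    using f phi by (rule d_tv_le_d2)
  define h where "h = fps_const (c3 / 3) * fps_X ^ 3 * fps_exp l + fps_const (c2\<^sup>2 / 8) * fps_X ^ 4 * fps_exp l"
  have "Abs_fps (\<lambda>m. binomial_moment m (sum_mass M n I)) - Abs_fps (\<lambda>m. binomial_moment m (phi2 n p)) \<lless> h"
  proof -
    have "Abs_fps (\<lambda>m. binomial_moment m (sum_mass M n I)) = (\<Prod>i\<in>{1..n}. 1 + fps_const (p i) * fps_X)"
      by (rule fps_ext)
        (simp only: fps_nth_Abs_fps binomial_moment_indicator_sum[of I n p, OF assms(3-5)])
    moreover have "Abs_fps (\<lambda>m. binomial_moment m (phi2 n p))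
        = (1 - fps_const (c2 / 2) * fps_X ^ 2) * fps_exp l"
      by (rule fps_ext) (simp only: fps_nth_Abs_fps phi2_binomial_moment[OF assms(6)] l_def c2_def)
    ultimately show ?thesis
      using prod_linear_second_order_majorized[of "{1..n}" p] p by (simp add: h_def sums)
  qed
  moreover have "(\<lambda>m. 2 ^ m * h $ m) sums (c3 / 3 * 2 ^ 3 * exp (2 * l) + c2\<^sup>2 / 8 * 2 ^ 4 * exp (2 * l))"
    unfolding h_def fps_add_nth distrib_left by (intro sums_add power_monomial_times_fps_exp_sums)
  ultimately have "d2 (sum_mass M n I) (phi2 n p)
      \<le> ennreal ((c3 / 3 * 2 ^ 3 * exp (2 * l) + c2\<^sup>2 / 8 * 2 ^ 4 * exp (2 * l)) / 2)"
    by (rule d2_le_of_majorized[OF f phi])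
  also have "(c3 / 3 * 2 ^ 3 * exp (2 * l) + c2\<^sup>2 / 8 * 2 ^ 4 * exp (2 * l)) / 2
      = (4 / 3 * c3 + c2\<^sup>2) * exp (2 * l)"
    by (simp add: algebra_simps)
  finally show "d2 (sum_mass M n I) (phi2 n p)
      \<le> ennreal ((4 / 3 * power_sum n p 3 + (power_sum n p 2)\<^sup>2) * exp (2 * power_sum n p 1))"
    by (simp add: l_def c2_def c3_def)
  have "c2\<^sup>2 \<le> l * c3"
    using sum_squares_squared_le[of "{1..n}" p] p by (simp add: sums)
  then have "(4 / 3 * c3 + c2\<^sup>2) * exp (2 * l) \<le> (4 / 3 * c3 + l * c3) * exp (2 * l)"
    by (intro mult_right_mono) auto
  also have "\<dots> = (4 / 3 + l) * exp (2 * l) * c3"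
    by (simp add: algebra_simps)
  finally show "(4 / 3 * power_sum n p 3 + (power_sum n p 2)\<^sup>2) * exp (2 * power_sum n p 1)
      \<le> (4 / 3 + power_sum n p 1) * exp (2 * power_sum n p 1) * (\<Sum>i = 1..n. p i ^ 3)"
    unfolding c3_def c2_def l_def by (simp only: power_sum_def)
qed

end
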